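(* For every $C>0$, the set of global minimizers over $(x,y)\in\mathbb{R}^p\times\mathbb{R}^q$ of the function $$h(x,y)=\Bigl(1-\frac C2\Bigr)(x^T\Sigma_x x)(y^T\Sigma_y y)+\frac C4 (x^T\Sigma_x x)^2+\frac C4 (y^T\Sigma_y y)^2-2x^T\Sigma_{xy}y$$ is exactly $\{+(\rho_0^{1/2}\alpha_0,\rho_0^{1/2}\beta_0),\,-(\rho_0^{1/2}\alpha_0,\rho_0^{1/2}\beta_0)\}$.
   Context: $X\in\mathbb{R}^p$ and $Y\in\mathbb{R}^q$ are centered random vectors with joint covariance matrix $\Sigma=\begin{bmatrix}\Sigma_x&\Sigma_{xy}\\ \Sigma_{yx}&\Sigma_y\end{bmatrix}$, $\Sigma_{yx}=\Sigma_{xy}^T$. $\Sigma_x$ and $\Sigma_y$ are positive definite. $\Sigma_{xy}$ has rank $r\ge 1$ and is decomposed as $\Sigma_{xy}=\Sigma_xU\Lambda V^T\Sigma_y$, where $U=[u_1\ \ldots\ u_r]\in\mathbb{R}^{p\times r}$, $V=[v_1\ \ldots\ v_r]\in\mathbb{R}^{q\times r}$ satisfy $U^T\Sigma_xU=V^T\Sigma_yV=I_r$, and $\Lambda=\mathrm{diag}(\Lambda_1,\ldots,\Lambda_r)$ with $\Lambda_1\ge\cdots\ge\Lambda_r>0$ (the canonical correlations). Write $\rho_0=\Lambda_1$, $\alpha_0=u_1$, $\beta_0=v_1$ (the first canonical correlation and directions, i.e. the maximum and maximizers of $\alpha^T\Sigma_{xy}\beta$ subject to $\alpha^T\Sigma_x\alpha=\beta^T\Sigma_y\beta=1$).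 With the convention $\Lambda_2=0$ if $r=1$, it is assumed that $\rho_0-\Lambda_2>0$, so $(\alpha_0,\beta_0)$ is unique up to a joint sign flip. *)

theory Defs
  imports "HOL-Probability.Probability"
begin

definition square_integrable_rv :: "'w measure \<Rightarrow> ('w \<Rightarrow> real ^ 'n) \<Rightarrow> bool" where
  "square_integrable_rv M X \<longleftrightarrow>
     X \<in> borel_measurable M \<and> integrable M (\<lambda>w. (norm (X w))\<^sup>2)"

text \<open>
  On a probability space, square integrability implies integrability, so that for the vectors
  considered here the integral below is the genuine mean and not the default value 0.
\<close>

definition centered :: "'w measure \<Rightarrow> ('w \<Rightarrow> real ^ 'n) \<Rightarrow> bool" where
  "centered M X \<longleftrightarrow> integral\<^sup>L M X = 0"

definition cross_cov :: "'w measure \<Rightarrow> ('w \<Rightarrow> real ^ 'm) \<Rightarrow> ('w \<Rightarrow> real ^ 'n) \<Rightarrow> real ^ 'n ^ 'm" where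
  "cross_cov M X Y =
     (\<chi> i j. integral\<^sup>L M (\<lambda>w. (X w - integral\<^sup>L M X) $ i * (Y w - integral\<^sup>L M Y) $ j))"

definition positive_definite :: "real ^ 'n ^ 'n \<Rightarrow> bool" where
  "positive_definite A \<longleftrightarrow> transpose A = A \<and> (\<forall>x. x \<noteq> 0 \<longrightarrow> 0 < x \<bullet> (A *v x))"

definition diag_mat :: "real ^ 'n \<Rightarrow> real ^ 'n ^ 'n" where
  "diag_mat d = (\<chi> i j. if i = j then d $ i else 0)"

text \<open>
  Index sets \<open>{1, ..., r}\<close> are finite linearly ordered types \<open>'r\<close> with \<open>CARD('r) = r\<close>;
  the least element of \<open>'r\<close> plays the role of the index 1 and its successor that of 2.
\<close>

definition first_index :: "'r::{finite,linorder}" where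
  "first_index = Min UNIV"

definition second_entry :: "real ^ 'r::{finite,linorder} \<Rightarrow> real" where
  "second_entry d = (if CARD('r) = 1 then 0 else d $ Min (UNIV - {first_index}))"

definition cca_objective ::
    "real \<Rightarrow> real ^ 'p ^ 'p \<Rightarrow> real ^ 'q ^ 'q \<Rightarrow> real ^ 'q ^ 'p \<Rightarrow> (real ^ 'p) \<times> (real ^ 'q) \<Rightarrow> real" where
  "cca_objective C Sx Sy Sxy = (\<lambda>(x, y).
     (1 - C / 2) * (x \<bullet> (Sx *v x)) * (y \<bullet> (Sy *v y))
     + C / 4 * (x \<bullet> (Sx *v x))\<^sup>2 + C / 4 * (y \<bullet> (Sy *v y))\<^sup>2
     - 2 * (x \<bullet> (Sxy *v y)))"

end

theory Submission
  imports Defs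
begin

text \<open>
  Put \<open>a = x\<^sup>T \<Sigma>\<^sub>x x\<close>, \<open>b = y\<^sup>T \<Sigma>\<^sub>y y\<close>, \<open>m = x\<^sup>T \<Sigma>\<^sub>x\<^sub>y y\<close> and pass to the canonical coordinates
  \<open>s = U\<^sup>T \<Sigma>\<^sub>x x\<close>, \<open>t = V\<^sup>T \<Sigma>\<^sub>y y\<close>, so that \<open>m = \<Sum>\<^sub>i \<Lambda>\<^sub>i s\<^sub>i t\<^sub>i\<close>, \<open>|s|\<^sup>2 \<le> a\<close> and \<open>|t|\<^sup>2 \<le> b\<close> (Bessel).
  Then \<open>\<rho>\<^sup>2 (h + \<rho>\<^sup>2) = (\<rho>\<^sup>2 a b - m\<^sup>2) + \<rho>\<^sup>2 C (a - b)\<^sup>2 / 4 + (m - \<rho>\<^sup>2)\<^sup>2\<close> is a sum of nonnegative terms,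
  so \<open>h \<ge> - \<rho>\<^sup>2\<close> with equality only if \<open>a = b = \<rho>\<close> and \<open>m = \<rho>\<^sup>2\<close>. In that case
  \<open>\<rho> (a + b) / 2 - m = 0\<close> splits into nonnegative terms again: the two Bessel defects and
  \<open>\<Lambda>\<^sub>i (s\<^sub>i - t\<^sub>i)\<^sup>2 / 2 + (\<rho> - \<Lambda>\<^sub>i) (s\<^sub>i\<^sup>2 + t\<^sub>i\<^sup>2) / 2\<close>. The spectral gap then forces \<open>s = t\<close> to be a
  multiple of the first basis vector.
\<close>

lemma inner_matrix_vector: "x \<bullet> (A *v y) = (transpose A *v x) \<bullet> y"
  for A :: "real ^ 'n ^ 'm"
  by (simp add: dot_lmul_matrix)

lemma matrix_vector_mult_uminus_right: "A *v (- x) = - (A *v x)"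
  for A :: "real ^ 'n ^ 'm"
  by (simp add: vec_eq_iff matrix_vector_mult_def sum_negf)

lemma diag_mat_mult_vec: "diag_mat d *v x = (\<chi> i. d $ i * x $ i)"
  by (simp add: vec_eq_iff diag_mat_def matrix_vector_mult_def if_distrib[where f = "\<lambda>c. c * _"]
      cong: if_cong)

lemma positive_definite_nonneg: "positive_definite S \<Longrightarrow> 0 \<le> x \<bullet> (S *v x)"
  by (cases "x = 0") (auto simp: positive_definite_def less_imp_le)

lemma orthonormal_columns_inverse:
  fixes U :: "real ^ 'r ^ 'n"
  assumes "transpose U ** S ** U = mat 1"
  shows "transpose U *v (S *v (U *v s)) = s"
  by (metis assms matrix_vector_mul_assoc matrix_vector_mul_lid)

lemma orthonormal_columns_quadratic_form:
  fixes U :: "real ^ 'r ^ 'n"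
  assumes "transpose U ** S ** U = mat 1"
  shows "(U *v s) \<bullet> (S *v (U *v s)) = s \<bullet> s"
  by (metis assms inner_commute inner_matrix_vector orthonormal_columns_inverse)

text \<open>\<open>U *v s x\<close> is the projection of \<open>x\<close> onto the column span of
  \<open>U\<close>, orthogonal for the inner product of \<open>S\<close>, so this is Pythagoras for
  the residual.\<close>

lemma bessel_defect:
  fixes U :: "real ^ 'r ^ 'n"
  assumes S: "positive_definite S" and U: "transpose U ** S ** U = mat 1"
  defines "s \<equiv> \<lambda>x. transpose U *v (S *v x)"
  shows "(x - U *v s x) \<bullet> (S *v (x - U *v s x)) = x \<bullet> (S *v x) - s x \<bullet> s x"
proof -
  have 1: "(U *v s x) \<bullet> (S *v x) = s x \<bullet> s x"
    by (metis inner_commute inner_matrix_vector s_def)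
  have "x \<bullet> (S *v (U *v s x)) = (S *v x) \<bullet> (U *v s x)"
    using S by (simp add: inner_matrix_vector[of x S] positive_definite_def)
  with 1 have 2: "x \<bullet> (S *v (U *v s x)) = s x \<bullet> s x"
    by (simp add: inner_commute)
  show ?thesis
    using 1 2 orthonormal_columns_quadratic_form[OF U, of "s x"]
    by (simp add: matrix_vector_mult_diff_distrib inner_diff_left inner_diff_right)
qed

lemma bessel_inequality:
  fixes U :: "real ^ 'r ^ 'n"
  assumes "positive_definite S" and "transpose U ** S ** U = mat 1"
  shows "(transpose U *v (S *v x)) \<bullet> (transpose U *v (S *v x)) \<le> x \<bullet> (S *v x)"
  using bessel_defect[OF assms, of x] positive_definite_nonneg[OF assms(1)] by (metis diff_ge_0_iff_ge)

text \<open>The defect is the quadratic form of the residual, so definiteness of \<open>S\<close>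
  makes the residual vanish once the defect does.\<close>

lemma bessel_equality:
  fixes U :: "real ^ 'r ^ 'n"
  assumes "positive_definite S" and "transpose U ** S ** U = mat 1"
    and "(transpose U *v (S *v x)) \<bullet> (transpose U *v (S *v x)) = x \<bullet> (S *v x)"
  shows "x = U *v (transpose U *v (S *v x))"
  using bessel_defect[OF assms(1,2), of x] assms(1,3)
  unfolding positive_definite_def by (metis diff_self eq_iff_diff_eq_0 less_irrefl)

lemma canonical_bilinear_form:
  fixes U :: "real ^ 'r ^ 'p" and V :: "real ^ 'r ^ 'q"
  assumes "positive_definite Sx"
  shows "x \<bullet> ((Sx ** U ** diag_mat L ** transpose V ** Sy) *v y) =
    (\<Sum>i\<in>UNIV. L $ i * (transpose U *v (Sx *v x)) $ i * (transpose V *v (Sy *v y)) $ i)"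
proof -
  have "x \<bullet> ((Sx ** U ** diag_mat L ** transpose V ** Sy) *v y) =
      (transpose U *v (Sx *v x)) \<bullet> (diag_mat L *v (transpose V *v (Sy *v y)))"
    using assms
    by (simp add: inner_matrix_vector[of _ Sx] inner_matrix_vector[of _ U] positive_definite_def
        flip: matrix_vector_mul_assoc)
  then show ?thesis
    by (simp add: diag_mat_mult_vec inner_vec_def mult_ac)
qed

text \<open>Cauchy-Schwarz with all weights moved onto \<open>s\<close>, where they enter squared
  and are bounded by the square of \<open>\<rho>\<close>.\<close>

lemma weighted_inner_square_le:
  fixes s t L :: "real ^ 'r"
  assumes "\<And>i. 0 \<le> L $ i" and "\<And>i. L $ i \<le> \<rho>"
  shows "(\<Sum>i\<in>UNIV. L $ i * s $ i * t $ i)\<^sup>2 \<le> \<rho>\<^sup>2 * (s \<bullet> s) * (t \<bullet> t)"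
proof -
  let ?u = "\<chi> i. L $ i * s $ i"
  have "?u \<bullet> ?u = (\<Sum>i\<in>UNIV. (L $ i)\<^sup>2 * (s $ i)\<^sup>2)"
    by (simp add: inner_vec_def power2_eq_square mult_ac)
  also have "\<dots> \<le> (\<Sum>i\<in>UNIV. \<rho>\<^sup>2 * (s $ i)\<^sup>2)"
    by (intro sum_mono mult_right_mono power_mono assms) auto
  also have "\<dots> = \<rho>\<^sup>2 * (s \<bullet> s)"
    by (simp add: inner_vec_def power2_eq_square sum_distrib_left)
  finally have "?u \<bullet> ?u \<le> \<rho>\<^sup>2 * (s \<bullet> s)" .
  then have "(?u \<bullet> t)\<^sup>2 \<le> \<rho>\<^sup>2 * (s \<bullet> s) * (t \<bullet> t)"
    using Cauchy_Schwarz_ineq[of ?u t] by (meson inner_ge_zero mult_right_mono order_trans)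
  then show ?thesis
    by (simp add: inner_vec_def)
qed

text \<open>An equality case: the reverse of \<open>eq\<close> always holds, by the nonnegativity of
  the \<open>d i\<close> below. Assuming an inequality suits the application, where Bessel supplies
  only that direction.\<close>

lemma weighted_inner_eq_top:
  fixes s t L :: "real ^ 'r"
  assumes pos: "\<And>i. 0 < L $ i" and le: "\<And>i. L $ i \<le> \<rho>"
    and gap: "\<And>i. i \<noteq> k \<Longrightarrow> L $ i < \<rho>"
    and eq: "\<rho> * (s \<bullet> s + t \<bullet> t) / 2 \<le> (\<Sum>i\<in>UNIV. L $ i * s $ i * t $ i)"
  shows "s = axis k (s $ k)" and "t = s"
proof -
  define d where
    "d i = L $ i / 2 * (s $ i - t $ i)\<^sup>2 + (\<rho> - L $ i) / 2 * ((s $ i)\<^sup>2 + (t $ i)\<^sup>2)" for i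
  have parts: "0 \<le> L $ i / 2 * (s $ i - t $ i)\<^sup>2"
      "0 \<le> (\<rho> - L $ i) / 2 * ((s $ i)\<^sup>2 + (t $ i)\<^sup>2)" for i
    using pos[of i] le[of i] by auto
  have "d i = \<rho> / 2 * (s $ i * s $ i + t $ i * t $ i) - L $ i * s $ i * t $ i" for i
    by (simp add: d_def field_simps power2_eq_square)
  then have "(\<Sum>i\<in>UNIV. d i) = \<rho> * (s \<bullet> s + t \<bullet> t) / 2 - (\<Sum>i\<in>UNIV. L $ i * s $ i * t $ i)"
    by (simp add: inner_vec_def sum_subtractf sum.distrib flip: sum_divide_distrib sum_distrib_left)
  then have "(\<Sum>i\<in>UNIV. d i) \<le> 0"
    using eq by simp
  moreover have d_nonneg: "0 \<le> d i" for i
    using parts[of i] by (simp add: d_def)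
  ultimately have "(\<Sum>i\<in>UNIV. d i) = 0"
    by (simp add: order_antisym sum_nonneg)
  then have "d i = 0" for i
    using d_nonneg by (simp add: sum_nonneg_eq_0_iff)
  then have zero: "L $ i / 2 * (s $ i - t $ i)\<^sup>2 = 0"
      "(\<rho> - L $ i) / 2 * ((s $ i)\<^sup>2 + (t $ i)\<^sup>2) = 0" for i
    using parts[of i] unfolding d_def by (metis add_nonneg_eq_0_iff)+
  show "t = s"
    using zero(1) pos by (auto simp: vec_eq_iff less_le)
  show "s = axis k (s $ k)"
    using zero(2) gap by (fastforce simp: vec_eq_iff axis_def)
qed

lemma entry_le_first:
  fixes L :: "real ^ ('r::{finite,linorder})"
  assumes "\<And>i j. i \<le> j \<Longrightarrow> L $ j \<le> L $ i"
  shows "L $ i \<le> L $ first_index"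
  by (simp add: assms first_index_def)

lemma entry_le_second:
  fixes L :: "real ^ ('r::{finite,linorder})"
  assumes "\<And>i j. i \<le> j \<Longrightarrow> L $ j \<le> L $ i" and "i \<noteq> first_index"
  shows "L $ i \<le> second_entry L"
proof -
  \<comment> \<open>A second index exists, so the default value 0 of \<open>second_entry\<close> is
    ruled out.\<close>
  have "CARD('r) \<noteq> 1"
    using assms(2) by (metis UNIV_I card_1_singletonE singletonD)
  moreover have "Min (UNIV - {first_index}) \<le> i"
    using assms(2) by simp
  ultimately show ?thesis
    by (simp add: second_entry_def assms(1))
qed

text \<open>The terms with \<open>C\<close> combine to \<open>C / 4\<close> times the square of the
  difference of the two quadratic forms; the rest completes a square in the bilinear form. The
  factor \<open>\<rho>\<^sup>2\<close> avoids division.\<close>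

lemma cca_objective_identity:
  "\<rho>\<^sup>2 * (cca_objective C Sx Sy Sxy (x, y) + \<rho>\<^sup>2) =
    (\<rho>\<^sup>2 * (x \<bullet> (Sx *v x)) * (y \<bullet> (Sy *v y)) - (x \<bullet> (Sxy *v y))\<^sup>2) +
    \<rho>\<^sup>2 * C / 4 * (x \<bullet> (Sx *v x) - y \<bullet> (Sy *v y))\<^sup>2 + (x \<bullet> (Sxy *v y) - \<rho>\<^sup>2)\<^sup>2"
  by (simp add: cca_objective_def) algebra

theorem lemma1:
  fixes M :: "'w measure"
    and X :: "'w \<Rightarrow> real ^ 'p" and Y :: "'w \<Rightarrow> real ^ 'q"
    and Sx :: "real ^ 'p ^ 'p" and Sy :: "real ^ 'q ^ 'q" and Sxy :: "real ^ 'q ^ 'p"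
    and U :: "real ^ ('r::{finite,linorder}) ^ 'p" and V :: "real ^ ('r::{finite,linorder}) ^ 'q"
    and L :: "real ^ ('r::{finite,linorder})"
    and \<rho>\<^sub>0 C :: real and \<alpha>\<^sub>0 :: "real ^ 'p" and \<beta>\<^sub>0 :: "real ^ 'q"
  assumes "prob_space M"
    and "square_integrable_rv M X" and "square_integrable_rv M Y"
    and "centered M X" and "centered M Y"
    and "Sx = cross_cov M X X" and "Sy = cross_cov M Y Y" and "Sxy = cross_cov M X Y"
    and "positive_definite Sx" and "positive_definite Sy"
    and "rank Sxy = CARD('r)"
    and "Sxy = Sx ** U ** diag_mat L ** transpose V ** Sy"
    and "transpose U ** Sx ** U = mat 1" and "transpose V ** Sy ** V = mat 1"
    and "\<And>i j. i \<le> j \<Longrightarrow> L $ j \<le> L $ i" and "\<And>i. L $ i > 0"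
    and "\<rho>\<^sub>0 = L $ first_index"
    and "\<alpha>\<^sub>0 = column first_index U" and "\<beta>\<^sub>0 = column first_index V"
    and "\<rho>\<^sub>0 - second_entry L > 0"
    and "C > 0"
  shows "{z. is_arg_min (cca_objective C Sx Sy Sxy) (\<lambda>_. True) z} =
    {(sqrt \<rho>\<^sub>0 *\<^sub>R \<alpha>\<^sub>0, sqrt \<rho>\<^sub>0 *\<^sub>R \<beta>\<^sub>0), - (sqrt \<rho>\<^sub>0 *\<^sub>R \<alpha>\<^sub>0, sqrt \<rho>\<^sub>0 *\<^sub>R \<beta>\<^sub>0)}"
proof -
  let ?k = "first_index :: 'r::{finite,linorder}"
  let ?h = "cca_objective C Sx Sy Sxy"
  let ?z = "(sqrt \<rho>\<^sub>0 *\<^sub>R \<alpha>\<^sub>0, sqrt \<rho>\<^sub>0 *\<^sub>R \<beta>\<^sub>0)"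
  note Sx = assms(9) and Sy = assms(10) and Sxy = assms(12) and U = assms(13) and V = assms(14)
    and mono = assms(15) and pos = assms(16) and rho = assms(17)
  have rho_pos: "0 < \<rho>\<^sub>0" and L_le: "L $ i \<le> \<rho>\<^sub>0" for i
    by (simp_all add: pos rho entry_le_first mono)
  have L_less: "L $ i < \<rho>\<^sub>0" if "i \<noteq> ?k" for i
    using entry_le_second[of L i, OF mono that] assms(20) by simp

  define s where "s x = transpose U *v (Sx *v x)" for x
  define t where "t y = transpose V *v (Sy *v y)" for y
  note canonical = canonical_bilinear_form[OF Sx, of _ U L V Sy, folded Sxy s_def t_def]

  \<comment> \<open>Written as images of a basis vector, the claimed minimizers have canonical
    coordinates that can be read off from orthonormality.\<close>
  have top: "sqrt \<rho>\<^sub>0 *\<^sub>R \<alpha>\<^sub>0 = U *v axis ?k (sqrt \<rho>\<^sub>0)" "sqrt \<rho>\<^sub>0 *\<^sub>R \<beta>\<^sub>0 = V *v axis ?k (sqrt \<rho>\<^sub>0)"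
    by (simp_all add: assms(18,19) vec_eq_iff matrix_vector_mult_def axis_def column_def
        if_distrib[where f = "\<lambda>c. _ * c"] mult.commute cong: if_cong)

  have m_sq: "(x \<bullet> (Sxy *v y))\<^sup>2 \<le> \<rho>\<^sub>0\<^sup>2 * (x \<bullet> (Sx *v x)) * (y \<bullet> (Sy *v y))" for x y
  proof -
    have "(x \<bullet> (Sxy *v y))\<^sup>2 \<le> \<rho>\<^sub>0\<^sup>2 * (s x \<bullet> s x) * (t y \<bullet> t y)"
      unfolding canonical by (intro weighted_inner_square_le L_le less_imp_le[OF pos])
    also have "\<dots> \<le> \<rho>\<^sub>0\<^sup>2 * (x \<bullet> (Sx *v x)) * (y \<bullet> (Sy *v y))"
      unfolding s_def t_def
      by (intro mult_mono bessel_inequality Sx Sy U V mult_nonneg_nonneg positive_definite_nonneg) auto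
    finally show ?thesis .
  qed

  have parts: "0 \<le> \<rho>\<^sub>0\<^sup>2 * (x \<bullet> (Sx *v x)) * (y \<bullet> (Sy *v y)) - (x \<bullet> (Sxy *v y))\<^sup>2"
      "0 \<le> \<rho>\<^sub>0\<^sup>2 * C / 4 * (x \<bullet> (Sx *v x) - y \<bullet> (Sy *v y))\<^sup>2"
      "0 \<le> (x \<bullet> (Sxy *v y) - \<rho>\<^sub>0\<^sup>2)\<^sup>2" for x y
    using m_sq[of x y] \<open>C > 0\<close> by auto
  have lower: "- \<rho>\<^sub>0\<^sup>2 \<le> ?h z" for z
  proof -
    obtain x y where z: "z = (x, y)" by force
    have "0 \<le> \<rho>\<^sub>0\<^sup>2 * (?h (x, y) + \<rho>\<^sub>0\<^sup>2)"
      unfolding cca_objective_identity by (intro add_nonneg_nonneg parts)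
    then show ?thesis
      using rho_pos by (simp add: z zero_le_mult_iff)
  qed

  have attained: "?h ?z = - \<rho>\<^sub>0\<^sup>2"
  proof -
    let ?e = "axis ?k (sqrt \<rho>\<^sub>0) :: real ^ 'r::{finite,linorder}"
    have e: "?e \<bullet> ?e = \<rho>\<^sub>0"
      using rho_pos by (simp add: inner_axis_axis)
    have "(U *v ?e) \<bullet> (Sxy *v (V *v ?e)) = (\<Sum>i\<in>UNIV. L $ i * ?e $ i * ?e $ i)"
      unfolding canonical s_def t_def
      by (simp only: orthonormal_columns_inverse[OF U] orthonormal_columns_inverse[OF V])
    also have "\<dots> = (\<Sum>i\<in>UNIV. if i = ?k then \<rho>\<^sub>0 * \<rho>\<^sub>0 else 0)"
      using rho_pos by (intro sum.cong) (auto simp: axis_def rho[symmetric] mult.assoc)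
    finally have "(U *v ?e) \<bullet> (Sxy *v (V *v ?e)) = \<rho>\<^sub>0\<^sup>2"
      by (simp add: power2_eq_square)
    then show ?thesis
      unfolding top
      by (simp add: cca_objective_def orthonormal_columns_quadratic_form[OF U]
          orthonormal_columns_quadratic_form[OF V] e power2_eq_square algebra_simps)
  qed
  \<comment> \<open>Every term has even total degree in \<open>(x, y)\<close>; this yields the
    second minimizer from the first.\<close>
  have neg: "?h (- z) = ?h z" for z
    by (cases z) (simp add: cca_objective_def matrix_vector_mult_uminus_right)

  have unique: "z = ?z \<or> z = - ?z" if "?h z = - \<rho>\<^sub>0\<^sup>2" for z
  proof -
    obtain x y where z: "z = (x, y)" by force
    define a b m where "a = x \<bullet> (Sx *v x)" and "b = y \<bullet> (Sy *v y)" and "m = x \<bullet> (Sxy *v y)"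
    have "(\<rho>\<^sub>0\<^sup>2 * a * b - m\<^sup>2) + \<rho>\<^sub>0\<^sup>2 * C / 4 * (a - b)\<^sup>2 + (m - \<rho>\<^sub>0\<^sup>2)\<^sup>2 = 0"
      using cca_objective_identity[of \<rho>\<^sub>0 C Sx Sy Sxy x y] that by (simp add: z a_def b_def m_def)
    then have "\<rho>\<^sub>0\<^sup>2 * a * b - m\<^sup>2 = 0" "\<rho>\<^sub>0\<^sup>2 * C / 4 * (a - b)\<^sup>2 = 0" "(m - \<rho>\<^sub>0\<^sup>2)\<^sup>2 = 0"
      using parts[of x y] unfolding a_def b_def m_def by linarith+
    \<comment> \<open>With \<open>b = a\<close> and \<open>m = \<rho>\<^sub>0\<^sup>2\<close>, the
      first vanishing term fixes the square of \<open>a\<close>.\<close>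
    then have ba: "b = a" and m: "m = \<rho>\<^sub>0\<^sup>2" and "a\<^sup>2 = \<rho>\<^sub>0\<^sup>2"
      using rho_pos \<open>C > 0\<close> by (auto simp: power2_eq_square)
    moreover have "0 \<le> a"
      unfolding a_def by (rule positive_definite_nonneg[OF Sx])
    ultimately have a: "a = \<rho>\<^sub>0"
      using rho_pos by (simp add: power2_eq_iff_nonneg)
    have sa: "s x \<bullet> s x \<le> a" and tb: "t y \<bullet> t y \<le> b"
      unfolding s_def t_def a_def b_def by (intro bessel_inequality Sx Sy U V)+
    have "\<rho>\<^sub>0 * (s x \<bullet> s x + t y \<bullet> t y) / 2 \<le> \<rho>\<^sub>0 * (a + b) / 2"
      using sa tb rho_pos by simp
    also have "\<dots> = m"
      by (simp add: a ba m power2_eq_square)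
    finally have "\<rho>\<^sub>0 * (s x \<bullet> s x + t y \<bullet> t y) / 2 \<le> (\<Sum>i\<in>UNIV. L $ i * s x $ i * t y $ i)"
      by (simp add: m_def canonical)
    from weighted_inner_eq_top[OF pos L_le L_less this]
    \<comment> \<open>One scalar \<open>c\<close> serves both vectors because
      \<open>t y = s x\<close>; this is why only a joint sign flip remains.\<close>
    obtain c where sx: "s x = axis ?k c" and ty: "t y = axis ?k c"
      by metis
    \<comment> \<open>Evaluating \<open>m\<close> in these coordinates determines \<open>c\<close>
      up to sign.\<close>
    have "\<rho>\<^sub>0\<^sup>2 = (\<Sum>i\<in>UNIV. if i = ?k then \<rho>\<^sub>0 * c\<^sup>2 else 0)"
      unfolding m[symmetric] m_def canonical sx ty
      by (intro sum.cong) (auto simp: axis_def rho power2_eq_square)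
    then have c: "c\<^sup>2 = \<rho>\<^sub>0"
      using rho_pos by (simp add: power2_eq_square)
    \<comment> \<open>Bessel is now tight on both sides, so \<open>x\<close> and \<open>y\<close>
      are recovered from their coordinates.\<close>
    then have "s x \<bullet> s x = a" "t y \<bullet> t y = b"
      by (simp_all add: sx ty a ba inner_axis_axis power2_eq_square)
    then have xy: "x = U *v axis ?k c" "y = V *v axis ?k c"
      using bessel_equality[OF Sx U, of x] bessel_equality[OF Sy V, of y] sx ty
      by (simp_all add: s_def t_def a_def b_def)
    have "c = sqrt \<rho>\<^sub>0 \<or> c = - sqrt \<rho>\<^sub>0"
      using c by (metis abs_if minus_minus real_sqrt_abs)
    moreover have "axis ?k (- sqrt \<rho>\<^sub>0) = - axis ?k (sqrt \<rho>\<^sub>0)"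
      by (simp add: vec_eq_iff axis_def)
    ultimately show ?thesis
      unfolding top z xy by (auto simp: matrix_vector_mult_uminus_right)
  qed
  \<comment> \<open>\<open>is_arg_min\<close> only excludes strictly smaller values; as the lower
    bound is attained, that forces equality with it.\<close>
  have "is_arg_min ?h (\<lambda>_. True) z \<longleftrightarrow> ?h z = - \<rho>\<^sub>0\<^sup>2" for z
    unfolding is_arg_min_def using lower attained by (metis leD order_le_less)
  then show ?thesis
    using unique attained neg by (auto simp del: uminus_Pair)
qed

end
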